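(* Let $\mathbb{A}$ be the Alexandroff-Urysohn double arrow space. Then the countably infinite power ${}^{\omega}\mathbb{A}$, with the product topology, is not countable dense homogeneous.
   Context: The Alexandroff-Urysohn double arrow space: let $\mathbb{A}_0=(0,1]\times\{0\}$, $\mathbb{A}_1=[0,1)\times\{1\}$ and $\mathbb{A}=\mathbb{A}_0\cup\mathbb{A}_1$, with the strict lexicographic order $\langle x,t\rangle<\langle y,s\rangle$ iff $x<y$, or $x=y$ and $t<s$; $\mathbb{A}$ carries the order topology. A separable Hausdorff space $X$ is countable dense homogeneous (CDH) if for any two countable dense subsets $D,E$ of $X$ there is a homeomorphism $h:X\to X$ with $h[D]=E$. *)

theory Defs
  imports "HOL-Analysis.Analysis"
begin

definition dense_in :: "'a topology \<Rightarrow> 'a set \<Rightarrow> bool" where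
  "dense_in X D \<longleftrightarrow> D \<subseteq> topspace X \<and> X closure_of D = topspace X"

text \<open>
  The notion is meant for separable Hausdorff spaces \<open>X\<close>. These standing assumptions are not
  conjuncts of the definition, so that a space cannot fail to be countable dense homogeneous
  merely because it is not separable or not Hausdorff.
\<close>
definition countable_dense_homogeneous :: "'a topology \<Rightarrow> bool" where
  "countable_dense_homogeneous X \<longleftrightarrow>
     (\<forall>D E. countable D \<and> dense_in X D \<and> countable E \<and> dense_in X E \<longrightarrow>
            (\<exists>h. homeomorphic_map X X h \<and> h ` D = E))"

lemma separable_space_if_not_cdh:
  "\<not> countable_dense_homogeneous X \<Longrightarrow> separable_space X"
  by (auto simp: countable_dense_homogeneous_def dense_in_def separable_space_def)

text \<open>
  The order topology of a strict order \<open>lt\<close> on a carrier \<open>S\<close>, generated by the open rays;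
  \<open>S\<close> itself is added so that it is the whole space also when \<open>S\<close> is a singleton.
\<close>
definition order_topology_on :: "'a set \<Rightarrow> ('a \<Rightarrow> 'a \<Rightarrow> bool) \<Rightarrow> 'a topology" where
  "order_topology_on S lt = topology_generated_by
     (insert S ((\<lambda>a. {x \<in> S. lt x a}) ` S \<union> (\<lambda>a. {x \<in> S. lt a x}) ` S))"

definition lex_less :: "real \<times> nat \<Rightarrow> real \<times> nat \<Rightarrow> bool" where
  "lex_less p q \<longleftrightarrow> fst p < fst q \<or> (fst p = fst q \<and> snd p < snd q)"

definition double_arrow_set :: "(real \<times> nat) set" where
  "double_arrow_set = {0<..1} \<times> {0} \<union> {0..<1} \<times> {1}"

definition double_arrow :: "(real \<times> nat) topology" where
  "double_arrow = order_topology_on double_arrow_set lex_less"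

definition double_arrow_power :: "(nat \<Rightarrow> real \<times> nat) topology" where
  "double_arrow_power = product_topology (\<lambda>_. double_arrow) UNIV"

lemma topspace_double_arrow [simp]: "topspace double_arrow = double_arrow_set"
  unfolding double_arrow_def order_topology_on_def topology_generated_by_topspace by auto

lemma Hausdorff_space_double_arrow: "Hausdorff_space double_arrow"
proof -
  let ?L = "\<lambda>a. {x \<in> double_arrow_set. lex_less x a}"
  let ?G = "\<lambda>a. {x \<in> double_arrow_set. lex_less a x}"
  have op: "openin double_arrow (?L a)" "openin double_arrow (?G a)"
    if "a \<in> double_arrow_set" for a
    unfolding double_arrow_def order_topology_on_def
    using that by (auto intro!: topology_generated_by_Basis)
  have sep: "\<exists>U V. openin double_arrow U \<and> openin double_arrow V \<and> p \<in> U \<and> q \<in> V \<and> disjnt U V"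
    if p: "p \<in> double_arrow_set" and q: "q \<in> double_arrow_set" and less: "lex_less p q" for p q
  proof (cases "\<exists>r \<in> double_arrow_set. lex_less p r \<and> lex_less r q")
    case True
    then obtain r where r: "r \<in> double_arrow_set" "lex_less p r" "lex_less r q"
      by blast
    have "disjnt (?L r) (?G r)"
      by (auto simp: disjnt_iff lex_less_def)
    with op[OF r(1)] r p q show ?thesis
      by blast
  next
    case False
    then have "disjnt (?L q) (?G p)"
      by (auto simp: disjnt_iff)
    with op(1)[OF q] op(2)[OF p] less p q show ?thesis
      by blast
  qed
  have total: "lex_less p q \<or> lex_less q p" if "p \<noteq> q" for p q
    using that by (cases p; cases q) (auto simp: lex_less_def)
  show ?thesis
    unfolding Hausdorff_space_def topspace_double_arrow
  proof (intro allI impI)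
    fix p q
    assume pq: "p \<in> double_arrow_set \<and> q \<in> double_arrow_set \<and> p \<noteq> q"
    then consider "lex_less p q" | "lex_less q p"
      using total by blast
    then show "\<exists>U V. openin double_arrow U \<and> openin double_arrow V \<and> p \<in> U \<and> q \<in> V \<and> disjnt U V"
      using sep pq by cases (blast, metis disjnt_sym)
  qed
qed

lemma Hausdorff_space_double_arrow_power: "Hausdorff_space double_arrow_power"
  by (simp add: double_arrow_power_def Hausdorff_space_product_topology
      Hausdorff_space_double_arrow)

end

theory Submission
  imports Defs
begin

text \<open>
  Idea: compare two countable dense sets. In the first one, \<open>E\<close>, distinct points differ in
  coordinate \<open>0\<close>. The second one, \<open>D\<close>, contains a dense subset \<open>Q\<close> of a Cantor cube
  \<open>{a, b}\<^sup>\<omega>\<close>. If a homeomorphism \<open>h\<close> maps \<open>D\<close> onto \<open>E\<close>, then \<open>h\<close> followed by the projection to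
  coordinate \<open>0\<close> is injective on \<open>Q\<close>. But a continuous image of a second countable space in the
  double arrow space is countable, so by the Baire category theorem one fibre of this map contains
  a nonempty open part of the Cantor cube, hence two points of \<open>Q\<close>.
\<close>

section \<open>The Cantor cube: cylinders, a dense countable set, and a Baire category
  argument\<close>

abbreviation cantor_cube :: "(nat \<Rightarrow> bool) topology" where
  "cantor_cube \<equiv> product_topology (\<lambda>_. discrete_topology UNIV) UNIV"

definition cylinder :: "bool list \<Rightarrow> (nat \<Rightarrow> bool) set" where
  "cylinder l = {t. \<forall>i < length l. t i = l ! i}"

lemma openin_cylinder: "openin cantor_cube (cylinder l)"
proof -
  have eq: "cylinder l = (\<Pi>\<^sub>E i\<in>UNIV. if i < length l then {l ! i} else UNIV)"
    by (auto simp: cylinder_def PiE_iff split: if_splits)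
  have "finite {i. (if i < length l then {l ! i} else UNIV) \<noteq> (UNIV :: bool set)}"
    by (rule finite_subset[of _ "{..<length l}"]) auto
  then show ?thesis
    unfolding eq by (auto simp: openin_PiE_gen)
qed

text \<open>A basic open box restricts only finitely many coordinates, so fixing the values of
  \<open>s\<close> below a bound for these coordinates is enough.\<close>

lemma cylinder_local_base:
  assumes "openin cantor_cube U" "s \<in> U"
  obtains l where "s \<in> cylinder l" "cylinder l \<subseteq> U"
proof -
  obtain V where V: "s \<in> (\<Pi>\<^sub>E i\<in>UNIV. V i)" "finite {i. V i \<noteq> UNIV}" "(\<Pi>\<^sub>E i\<in>UNIV. V i) \<subseteq> U"
    using product_topology_open_contains_basis[OF assms] by auto
  obtain n where n: "\<And>i. V i \<noteq> UNIV \<Longrightarrow> i < n"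
    using V(2) finite_nat_set_iff_bounded by auto
  have "cylinder (map s [0..<n]) \<subseteq> (\<Pi>\<^sub>E i\<in>UNIV. V i)"
  proof
    fix t assume t: "t \<in> cylinder (map s [0..<n])"
    have "t i \<in> V i" for i
    proof (cases "i < n")
      case True
      then have "t i = s i" using t by (simp add: cylinder_def)
      then show ?thesis using V(1) by (auto simp: PiE_iff)
    next
      case False
      then show ?thesis using n by blast
    qed
    then show "t \<in> (\<Pi>\<^sub>E i\<in>UNIV. V i)" by (simp add: PiE_iff)
  qed
  moreover have "s \<in> cylinder (map s [0..<n])" by (simp add: cylinder_def)
  ultimately show thesis
    by (intro that[of "map s [0..<n]"] subset_trans[OF _ V(3)])
qed

lemma second_countable_cantor_cube: "second_countable cantor_cube"
  unfolding second_countable_def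
proof (intro exI[of _ "range cylinder"] conjI strip)
  show "countable (range cylinder)" by simp
next
  fix V assume "V \<in> range cylinder"
  then show "openin cantor_cube V" using openin_cylinder by blast
next
  fix U s assume "openin cantor_cube U \<and> s \<in> U"
  then show "\<exists>V\<in>range cylinder. s \<in> V \<and> V \<subseteq> U"
    using cylinder_local_base by (metis rangeI)
qed

text \<open>The sequences with finitely many entries \<open>True\<close>, parametrized as finite
  lists padded with \<open>False\<close> so that countability is immediate.\<close>

definition cantor_rationals :: "(nat \<Rightarrow> bool) set" where
  "cantor_rationals = range (\<lambda>l i. i < length l \<and> l ! i)"

lemma countable_cantor_rationals: "countable cantor_rationals"
  by (simp add: cantor_rationals_def)

lemma cantor_open_two_rationals:
  assumes "openin cantor_cube U" "U \<noteq> {}"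
  obtains s t where "s \<in> cantor_rationals \<inter> U" "t \<in> cantor_rationals \<inter> U" "s \<noteq> t"
proof -
  obtain l where l: "cylinder l \<subseteq> U"
    using assms cylinder_local_base by blast
  \<comment> \<open>Two continuations of \<open>l\<close>: padding with \<open>False\<close>, and
    the same after one more \<open>True\<close>. They differ exactly at index
    \<open>length l\<close>.\<close>
  define s where "s = (\<lambda>i. i < length l \<and> l ! i)"
  define t where "t = (\<lambda>i. i < length (l @ [True]) \<and> (l @ [True]) ! i)"
  have "s \<in> cantor_rationals" "t \<in> cantor_rationals"
    unfolding cantor_rationals_def s_def t_def by blast+
  moreover have "s \<in> cylinder l" "t \<in> cylinder l"
    by (auto simp: s_def t_def cylinder_def nth_append)
  moreover have "s (length l) \<noteq> t (length l)"
    by (simp add: s_def t_def)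
  ultimately show thesis using l that by blast
qed

text \<open>Countably many closed fibres cover the cube. A fibre with nonempty interior would
  contain two rationals with equal value, so injectivity makes all interiors empty, against
  Baire.\<close>

lemma not_inj_on_cantor_rationals:
  assumes cont: "continuous_map cantor_cube Y f" and "Hausdorff_space Y"
    and count: "countable (range f)"
  shows "\<not> inj_on f cantor_rationals"
proof
  assume inj: "inj_on f cantor_rationals"
  define fibre where "fibre y = {s. f s = y}" for y
  have closed: "closedin cantor_cube (fibre y)" if "y \<in> range f" for y
  proof -
    have "closedin Y {y}"
      using that cont \<open>Hausdorff_space Y\<close> by (auto simp: continuous_map_def closedin_Hausdorff_sing_eq)
    then have "closedin cantor_cube {s \<in> topspace cantor_cube. f s \<in> {y}}"
      using cont closedin_continuous_map_preimage by blast
    then show ?thesis by (simp add: fibre_def)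
  qed
  have empty: "cantor_cube interior_of fibre y = {}" for y
  proof (rule ccontr)
    assume "cantor_cube interior_of fibre y \<noteq> {}"
    then obtain s t where "s \<in> cantor_rationals" "t \<in> cantor_rationals" "s \<noteq> t"
        "s \<in> cantor_cube interior_of fibre y" "t \<in> cantor_cube interior_of fibre y"
      using cantor_open_two_rationals[OF openin_interior_of] by (metis IntE)
    moreover have "cantor_cube interior_of fibre y \<subseteq> fibre y"
      by (rule interior_of_subset)
    ultimately show False
      using inj by (auto simp: fibre_def inj_on_def)
  qed
  have compact: "compact_space cantor_cube"
    by (simp add: compact_space_product_topology compact_space_discrete_topology)
  have Hausdorff: "Hausdorff_space cantor_cube"
    by (simp add: Hausdorff_space_product_topology)
  have "cantor_cube interior_of \<Union>(fibre ` range f) = {}"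
  proof (rule Baire_category_alt)
    \<comment> \<open>The second alternative holds, because the cube is compact Hausdorff.\<close>
    show "completely_metrizable_space cantor_cube \<or>
        locally_compact_space cantor_cube \<and> regular_space cantor_cube"
      using compact Hausdorff compact_Hausdorff_imp_regular_space compact_imp_locally_compact_space
      by blast
  qed (use closed empty count in auto)
  moreover have "\<Union>(fibre ` range f) = topspace cantor_cube"
    by (auto simp: fibre_def)
  ultimately have "topspace cantor_cube = {}"
    by (metis interior_of_topspace)
  then show False by simp
qed

section \<open>Second countable spaces have countable images in the double arrow space\<close>

lemma openin_double_arrow_rays:
  assumes "a \<in> double_arrow_set"
  shows "openin double_arrow {p \<in> double_arrow_set. lex_less p a}"
    and "openin double_arrow {p \<in> double_arrow_set. lex_less a p}"
  unfolding double_arrow_def order_topology_on_def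
  using assms by (auto intro!: topology_generated_by_Basis)

text \<open>The point \<open>(x, 1)\<close> has the immediate predecessor \<open>(x, 0)\<close>, so
  the closed ray from it is an open ray from \<open>(x, 0)\<close>; for \<open>x = 0\<close> it is
  the least point and the ray is the whole space.\<close>

lemma openin_double_arrow_upper:
  assumes "0 \<le> x" "x < 1"
  shows "openin double_arrow {p \<in> double_arrow_set. \<not> lex_less p (x, 1)}"
proof (cases "x = 0")
  case True
  then have "{p \<in> double_arrow_set. \<not> lex_less p (x, 1)} = topspace double_arrow"
    by (auto simp: double_arrow_set_def lex_less_def)
  then show ?thesis by (metis openin_topspace)
next
  case False
  then have "{p \<in> double_arrow_set. \<not> lex_less p (x, 1)} = {p \<in> double_arrow_set. lex_less (x, 0) p}"
    by (auto simp: double_arrow_set_def lex_less_def)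
  moreover have "(x, 0) \<in> double_arrow_set"
    using False assms by (simp add: double_arrow_set_def)
  ultimately show ?thesis using openin_double_arrow_rays(2) by metis
qed

text \<open>Mirror image: \<open>(x, 0)\<close> has the immediate successor \<open>(x, 1)\<close>,
  or is the greatest point when \<open>x = 1\<close>.\<close>

lemma openin_double_arrow_lower:
  assumes "0 < x" "x \<le> 1"
  shows "openin double_arrow {p \<in> double_arrow_set. \<not> lex_less (x, 0) p}"
proof (cases "x = 1")
  case True
  then have "{p \<in> double_arrow_set. \<not> lex_less (x, 0) p} = topspace double_arrow"
    by (auto simp: double_arrow_set_def lex_less_def)
  then show ?thesis by (metis openin_topspace)
next
  case False
  then have "{p \<in> double_arrow_set. \<not> lex_less (x, 0) p} = {p \<in> double_arrow_set. lex_less p (x, 1)}"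
    by (auto simp: double_arrow_set_def lex_less_def)
  moreover have "(x, 1) \<in> double_arrow_set"
    using False assms by (simp add: double_arrow_set_def)
  ultimately show ?thesis using openin_double_arrow_rays(1) by metis
qed

text \<open>Choose a base element \<open>B x\<close> between the point \<open>k x\<close> and the
  set \<open>U x\<close>. If \<open>B x = B y\<close>, then \<open>k x\<close> lies in
  \<open>U y\<close> and \<open>k y\<close> in \<open>U x\<close>, which \<open>sep\<close> excludes
  for distinct indices. Hence \<open>B\<close> injects \<open>S\<close> into a countable
  base.\<close>

lemma countable_if_separating_open_sets:
  assumes second: "second_countable X"
    and k: "\<And>x. x \<in> S \<Longrightarrow> openin X (U x) \<and> k x \<in> U x"
    and sep: "\<And>x y. x \<in> S \<Longrightarrow> y \<in> S \<Longrightarrow> x \<noteq> y \<Longrightarrow> k x \<notin> U y \<or> k y \<notin> U x"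
  shows "countable S"
proof -
  obtain \<B> where "countable \<B>"
    and base: "\<And>V x. openin X V \<and> x \<in> V \<Longrightarrow> \<exists>B\<in>\<B>. x \<in> B \<and> B \<subseteq> V"
    using second unfolding second_countable_def by blast
  have "\<forall>x\<in>S. \<exists>B\<in>\<B>. k x \<in> B \<and> B \<subseteq> U x"
    using base k by blast
  then obtain B where B: "\<And>x. x \<in> S \<Longrightarrow> B x \<in> \<B> \<and> k x \<in> B x \<and> B x \<subseteq> U x"
    by metis
  have "inj_on B S"
  proof (rule inj_onI)
    fix x y assume "x \<in> S" "y \<in> S" "B x = B y"
    with B sep show "x = y" by blast
  qed
  moreover have "countable (B ` S)"
    using B \<open>countable \<B>\<close> by (meson countable_subset image_subsetI)
  ultimately show ?thesis
    using countable_image_inj_on by blast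
qed

text \<open>The two levels are treated separately. The separating sets are the preimages of the
  closed rays starting at \<open>(x, 1)\<close>, respectively ending at \<open>(x, 0)\<close>, which
  are open.\<close>

lemma countable_image_double_arrow:
  assumes second: "second_countable X" and cont: "continuous_map X double_arrow f"
  shows "countable (f ` topspace X)"
proof -
  define S where "S t = {x. (x, t) \<in> f ` topspace X}" for t
  define k where "k t x = (SOME z. z \<in> topspace X \<and> f z = (x, t))" for t x
  have k: "k t x \<in> topspace X \<and> f (k t x) = (x, t)" if "x \<in> S t" for t x
  proof -
    have "\<exists>z. z \<in> topspace X \<and> f z = (x, t)"
      using that by (auto simp: S_def)
    then show ?thesis
      unfolding k_def by (rule someI_ex)
  qed
  have img: "f ` topspace X \<subseteq> double_arrow_set"
    using cont continuous_map_image_subset_topspace by fastforce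
  have range: "(x, t) \<in> double_arrow_set" if "x \<in> S t" for t x
    using img that by (auto simp: S_def)
  have pre: "openin X {z \<in> topspace X. f z \<in> W}" if "openin double_arrow W" for W
    using cont that openin_continuous_map_preimage by blast
  have "countable (S 1)"
  proof (rule countable_if_separating_open_sets[OF second])
    fix x assume x: "x \<in> S 1"
    then have "0 \<le> x" "x < 1"
      using range[OF x] by (auto simp: double_arrow_set_def)
    then show "openin X {z \<in> topspace X. f z \<in> {p \<in> double_arrow_set. \<not> lex_less p (x, 1)}} \<and>
        k 1 x \<in> {z \<in> topspace X. f z \<in> {p \<in> double_arrow_set. \<not> lex_less p (x, 1)}}"
      using pre[OF openin_double_arrow_upper] k[OF x] range[OF x] by (auto simp: lex_less_def)
  next
    \<comment> \<open>The smaller of the two points lies outside the upper ray of the larger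
      one.\<close>
    fix x y assume "x \<in> S 1" "y \<in> S 1" "x \<noteq> y"
    then show "k 1 x \<notin> {z \<in> topspace X. f z \<in> {p \<in> double_arrow_set. \<not> lex_less p (y, 1)}} \<or>
        k 1 y \<notin> {z \<in> topspace X. f z \<in> {p \<in> double_arrow_set. \<not> lex_less p (x, 1)}}"
      using k by (auto simp: lex_less_def)
  qed
  moreover have "countable (S 0)"
  proof (rule countable_if_separating_open_sets[OF second])
    fix x assume x: "x \<in> S 0"
    then have "0 < x" "x \<le> 1"
      using range[OF x] by (auto simp: double_arrow_set_def)
    then show "openin X {z \<in> topspace X. f z \<in> {p \<in> double_arrow_set. \<not> lex_less (x, 0) p}} \<and>
        k 0 x \<in> {z \<in> topspace X. f z \<in> {p \<in> double_arrow_set. \<not> lex_less (x, 0) p}}"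
      using pre[OF openin_double_arrow_lower] k[OF x] range[OF x] by (auto simp: lex_less_def)
  next
    \<comment> \<open>Here the larger point lies outside the lower ray of the smaller one.\<close>
    fix x y assume "x \<in> S 0" "y \<in> S 0" "x \<noteq> y"
    then show "k 0 x \<notin> {z \<in> topspace X. f z \<in> {p \<in> double_arrow_set. \<not> lex_less (y, 0) p}} \<or>
        k 0 y \<notin> {z \<in> topspace X. f z \<in> {p \<in> double_arrow_set. \<not> lex_less (x, 0) p}}"
      using k by (auto simp: lex_less_def)
  qed
  moreover have "f ` topspace X \<subseteq> S 0 \<times> {0} \<union> S 1 \<times> {1}"
    using img by (auto simp: S_def double_arrow_set_def)
  moreover have "countable (S 0 \<times> {0 :: nat} \<union> S 1 \<times> {1})"
    using calculation by simp
  ultimately show ?thesis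
    using countable_subset by blast
qed

section \<open>Countably many strips and boxes that refine all nonempty open sets\<close>

definition strip :: "real \<Rightarrow> real \<Rightarrow> (real \<times> nat) set" where
  "strip q r = {p \<in> double_arrow_set. q < fst p \<and> fst p < r}"

lemma infinite_strip:
  assumes "0 \<le> q" "q < r" "r \<le> 1"
  shows "infinite (strip q r)"
proof
  assume "finite (strip q r)"
  then have "finite (fst ` strip q r)" by simp
  moreover have "{q<..<r} \<subseteq> fst ` strip q r"
  proof
    fix x assume "x \<in> {q<..<r}"
    then have "(x, 1) \<in> strip q r"
      using assms by (auto simp: strip_def double_arrow_set_def)
    then show "x \<in> fst ` strip q r" by force
  qed
  ultimately show False
    using infinite_Ioo[OF assms(2)] finite_subset by blast
qed

text \<open>Neighbourhoods are one-sided: level 1 looks to the right and level 0 to the left. The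
  proof is by induction on the generation of the topology; for an intersection the shorter of two
  strips works.\<close>

lemma double_arrow_local_strips:
  assumes "openin double_arrow U"
  shows "((x, 1) \<in> U \<longrightarrow> (\<exists>r>x. strip x r \<subseteq> U)) \<and> ((x, 0) \<in> U \<longrightarrow> (\<exists>q<x. strip q x \<subseteq> U))"
proof -
  have "generate_topology_on (insert double_arrow_set
      ((\<lambda>a. {p \<in> double_arrow_set. lex_less p a}) ` double_arrow_set \<union>
       (\<lambda>a. {p \<in> double_arrow_set. lex_less a p}) ` double_arrow_set)) U"
    using assms unfolding double_arrow_def order_topology_on_def
    by (simp add: openin_topology_generated_by_iff)
  then show ?thesis
  proof induction
    case Empty
    then show ?case by simp
  next
    case (Int a b)
    have mono: "strip q r \<subseteq> strip q' r'" if "q' \<le> q" "r \<le> r'" for q r q' r'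
      using that by (auto simp: strip_def)
    have "\<exists>r>x. strip x r \<subseteq> a \<inter> b" if xab: "(x, 1) \<in> a \<inter> b"
    proof -
      obtain r r' where "r > x" "strip x r \<subseteq> a" "r' > x" "strip x r' \<subseteq> b"
        using Int xab by blast
      then show ?thesis
        using mono[of x x "min r r'" r] mono[of x x "min r r'" r']
        by (intro exI[of _ "min r r'"]) auto
    qed
    moreover have "\<exists>q<x. strip q x \<subseteq> a \<inter> b" if xab: "(x, 0) \<in> a \<inter> b"
    proof -
      obtain q q' where "q < x" "strip q x \<subseteq> a" "q' < x" "strip q' x \<subseteq> b"
        using Int xab by blast
      then show ?thesis
        using mono[of q "max q q'" x x] mono[of q' "max q q'" x x]
        by (intro exI[of _ "max q q'"]) auto
    qed
    ultimately show ?case by blast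
  next
    case (UN K)
    then show ?case by (meson Union_iff Sup_upper subset_trans)
  next
    case (Basis s)
    then consider "s = double_arrow_set"
      | a where "a \<in> double_arrow_set" "s = {p \<in> double_arrow_set. lex_less p a}"
      | a where "a \<in> double_arrow_set" "s = {p \<in> double_arrow_set. lex_less a p}"
      by auto
    then show ?case
    proof cases
      case 1
      then show ?thesis
        by (auto simp: strip_def intro: gt_ex lt_ex)
    next
      case (2 a)
      \<comment> \<open>Below \<open>a\<close>, a strip to the right of \<open>x\<close> has to stop
        at \<open>fst a\<close>, whereas the left end \<open>x - 1\<close> is an arbitrary smaller
        number. The next case is symmetric.\<close>
      have "strip x (fst a) \<subseteq> s" "x \<le> fst a \<Longrightarrow> strip (x - 1) x \<subseteq> s"
        using 2 by (auto simp: lex_less_def strip_def)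
      moreover have "(x, 1) \<in> s \<Longrightarrow> x < fst a" "(x, 0) \<in> s \<Longrightarrow> x \<le> fst a"
        using 2 by (auto simp: lex_less_def double_arrow_set_def)
      moreover have "x - 1 < x" by simp
      ultimately show ?thesis by blast
    next
      case (3 a)
      have "strip (fst a) x \<subseteq> s" "fst a \<le> x \<Longrightarrow> strip x (x + 1) \<subseteq> s"
        using 3 by (auto simp: lex_less_def strip_def)
      moreover have "(x, 0) \<in> s \<Longrightarrow> fst a < x" "(x, 1) \<in> s \<Longrightarrow> fst a \<le> x"
        using 3 by (auto simp: lex_less_def double_arrow_set_def)
      moreover have "x < x + 1" by simp
      ultimately show ?thesis by blast
    qed
  qed
qed

text \<open>Rational endpoints give countability; keeping the intervals nondegenerate and inside the
  unit interval makes their strips infinite.\<close>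

definition rational_intervals :: "(real \<times> real) set" where
  "rational_intervals = {(q, r). q \<in> \<rat> \<and> r \<in> \<rat> \<and> 0 \<le> q \<and> q < r \<and> r \<le> 1}"

lemma countable_rational_intervals: "countable rational_intervals"
  by (rule countable_subset[of _ "\<rat> \<times> \<rat>"])
    (auto simp: rational_intervals_def countable_rat)

text \<open>Any point of \<open>U\<close> has a one-sided strip in \<open>U\<close>. Cut it off at 0
  or 1 and shrink it to rational endpoints. The point itself may be lost, so this refines open sets
  without giving a neighbourhood base.\<close>

lemma double_arrow_pi_base:
  assumes "openin double_arrow U" "U \<noteq> {}"
  shows "\<exists>(q, r) \<in> rational_intervals. strip q r \<subseteq> U"
proof -
  have U: "U \<subseteq> double_arrow_set"
    using openin_subset[OF assms(1)] by simp
  obtain x t where xt: "(x, t) \<in> U" using assms(2) by auto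
  have "\<exists>u v. 0 \<le> u \<and> u < v \<and> v \<le> 1 \<and> strip u v \<subseteq> U"
  proof (cases "t = 1")
    case True
    then obtain r where "r > x" "strip x r \<subseteq> U"
      using double_arrow_local_strips[OF assms(1)] xt by blast
    moreover have "0 \<le> x" "x < 1"
      using U xt True by (auto simp: double_arrow_set_def)
    moreover have "strip x (min r 1) \<subseteq> strip x r"
      by (auto simp: strip_def)
    ultimately show ?thesis
      by (intro exI[of _ x] exI[of _ "min r 1"]) auto
  next
    case False
    then have x: "t = 0" "0 < x" "x \<le> 1"
      using U xt by (auto simp: double_arrow_set_def)
    then obtain q where "q < x" "strip q x \<subseteq> U"
      using double_arrow_local_strips[OF assms(1)] xt by blast
    moreover have "strip (max q 0) x \<subseteq> strip q x"
      by (auto simp: strip_def)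
    ultimately show ?thesis
      using x by (intro exI[of _ "max q 0"] exI[of _ x]) auto
  qed
  then obtain u v where uv: "0 \<le> u" "u < v" "v \<le> 1" "strip u v \<subseteq> U"
    by blast
  obtain q where q: "q \<in> \<rat>" "u < q" "q < v"
    using Rats_dense_in_real[OF uv(2)] by blast
  obtain r where r: "r \<in> \<rat>" "q < r" "r < v"
    using Rats_dense_in_real[OF q(3)] by blast
  have "(q, r) \<in> rational_intervals"
    using q r uv by (simp add: rational_intervals_def)
  moreover have "strip q r \<subseteq> U"
    using q r uv(4) by (auto simp: strip_def)
  ultimately show ?thesis by blast
qed

text \<open>Indexing by finite lists restricts an initial segment of the coordinates and keeps the
  family of boxes countable.\<close>

definition rational_box :: "(real \<times> real) list \<Rightarrow> (nat \<Rightarrow> real \<times> nat) set" where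
  "rational_box l = {x. (\<forall>i. x i \<in> double_arrow_set) \<and>
     (\<forall>i < length l. x i \<in> strip (fst (l ! i)) (snd (l ! i)))}"

lemma double_arrow_power_pi_base:
  assumes "openin double_arrow_power U" "U \<noteq> {}"
  shows "\<exists>l \<in> lists rational_intervals - {[]}. rational_box l \<subseteq> U"
proof -
  obtain x where "x \<in> U" using assms(2) by blast
  then have "\<exists>V. x \<in> (\<Pi>\<^sub>E i\<in>UNIV. V i) \<and> (\<forall>i. openin double_arrow (V i)) \<and>
      finite {i. V i \<noteq> double_arrow_set} \<and> (\<Pi>\<^sub>E i\<in>UNIV. V i) \<subseteq> U"
    using product_topology_open_contains_basis[OF assms(1)[unfolded double_arrow_power_def], of x]
    by simp
  then obtain V where V: "x \<in> (\<Pi>\<^sub>E i\<in>UNIV. V i)" "\<And>i. openin double_arrow (V i)"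
      "finite {i. V i \<noteq> double_arrow_set}" "(\<Pi>\<^sub>E i\<in>UNIV. V i) \<subseteq> U"
    by blast
  obtain n where n: "\<And>i. V i \<noteq> double_arrow_set \<Longrightarrow> i < n"
    using V(3) finite_nat_set_iff_bounded by auto
  have "V i \<noteq> {}" for i
    using V(1) by (auto simp: PiE_iff)
  then have "\<exists>p \<in> rational_intervals. strip (fst p) (snd p) \<subseteq> V i" for i
    using double_arrow_pi_base[OF V(2), of i] by (force simp: case_prod_unfold)
  then obtain p where p: "\<And>i. p i \<in> rational_intervals"
      "\<And>i. strip (fst (p i)) (snd (p i)) \<subseteq> V i"
    by metis
  \<comment> \<open>Taking \<open>Suc n\<close> instead of \<open>n\<close> makes the list nonempty,
    so coordinate 0 is always confined to a strip. The extra strip only shrinks the box.\<close>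
  define l where "l = map p [0..<Suc n]"
  have "rational_box l \<subseteq> (\<Pi>\<^sub>E i\<in>UNIV. V i)"
  proof
    fix y assume y: "y \<in> rational_box l"
    have "y i \<in> V i" for i
    proof (cases "i < n")
      case True
      then have "y i \<in> strip (fst (p i)) (snd (p i))"
        using y by (auto simp: rational_box_def l_def simp del: upt_Suc)
      then show ?thesis using p(2) by blast
    next
      case False
      then have "V i = double_arrow_set" using n by blast
      then show ?thesis using y by (simp add: rational_box_def)
    qed
    then show "y \<in> (\<Pi>\<^sub>E i\<in>UNIV. V i)" by (simp add: PiE_iff)
  qed
  moreover have "l \<in> lists rational_intervals - {[]}"
    using p(1) by (auto simp: l_def)
  ultimately show ?thesis using V(4) by blast
qed

section \<open>A countable dense set whose points differ in coordinate 0\<close>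

text \<open>Since \<open>l\<close> is nonempty, coordinate 0 ranges over an infinite strip, which a
  finite set cannot exhaust. The coordinates are chosen independently, with \<open>(1, 0)\<close> as
  default beyond the list.\<close>

lemma rational_box_avoiding:
  assumes l: "l \<in> lists rational_intervals - {[]}" and "finite F"
  shows "\<exists>x \<in> rational_box l. x 0 \<notin> F"
proof -
  have inf: "infinite (strip (fst (l ! i)) (snd (l ! i)))" if "i < length l" for i
  proof -
    have "l ! i \<in> rational_intervals" using l that by auto
    then show ?thesis
      by (intro infinite_strip) (auto simp: rational_intervals_def)
  qed
  have "\<exists>p \<in> double_arrow_set. (i < length l \<longrightarrow> p \<in> strip (fst (l ! i)) (snd (l ! i))) \<and>
      (i = 0 \<longrightarrow> p \<notin> F)" for i
  proof (cases "i < length l")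
    case True
    have "strip (fst (l ! i)) (snd (l ! i)) - F \<noteq> {}"
      using inf[OF True] \<open>finite F\<close> by (metis Diff_infinite_finite finite.emptyI)
    then show ?thesis by (auto simp: strip_def)
  next
    case False
    then have "i \<noteq> 0" using l by (cases i) auto
    moreover have "(1, 0) \<in> double_arrow_set" by (simp add: double_arrow_set_def)
    ultimately show ?thesis using False by blast
  qed
  then obtain x where "\<And>i. x i \<in> double_arrow_set \<and>
      (i < length l \<longrightarrow> x i \<in> strip (fst (l ! i)) (snd (l ! i))) \<and> (i = 0 \<longrightarrow> x i \<notin> F)"
    by metis
  then show ?thesis by (auto simp: rational_box_def)
qed

lemma topspace_double_arrow_power: "topspace double_arrow_power = {x. \<forall>i. x i \<in> double_arrow_set}"
  by (auto simp: double_arrow_power_def)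

text \<open>Enumerate the boxes and pick recursively a point of the \<open>n\<close>-th box whose
  coordinate 0 is new. Density follows because every nonempty open set contains a box.\<close>

lemma dense_set_inj_on_coordinate:
  obtains E where "countable E" "dense_in double_arrow_power E" "inj_on (\<lambda>x. x 0) E"
proof -
  define L where "L = lists rational_intervals - {[]}"
  define c where "c = from_nat_into L"
  have "countable L"
    unfolding L_def using countable_rational_intervals by (intro countable_Diff countable_lists)
  have "(0, 1) \<in> rational_intervals" by (simp add: rational_intervals_def)
  then have "[(0, 1)] \<in> L" by (simp add: L_def)
  then have "L \<noteq> {}" by blast
  have c: "range c = L"
    unfolding c_def using \<open>countable L\<close> \<open>L \<noteq> {}\<close> by (simp add: range_from_nat_into)
  have "\<exists>e. \<forall>n. e n \<in> rational_box (c n) \<and> e n 0 \<notin> (\<lambda>m. e m 0) ` {..<n}"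
  \<comment> \<open>Course-of-values recursion: the forbidden set at stage \<open>n\<close> is
    finite and depends only on the values of \<open>e\<close> below \<open>n\<close>.\<close>
  proof (rule dependent_wellorder_choice)
    fix n and e :: "nat \<Rightarrow> nat \<Rightarrow> real \<times> nat"
    have "c n \<in> lists rational_intervals - {[]}" using c L_def by blast
    then show "\<exists>x. x \<in> rational_box (c n) \<and> x 0 \<notin> (\<lambda>m. e m 0) ` {..<n}"
      using rational_box_avoiding[of "c n" "(\<lambda>m. e m 0) ` {..<n}"] by auto
  qed auto
  then obtain e where e: "\<And>n. e n \<in> rational_box (c n)" "\<And>n. e n 0 \<notin> (\<lambda>m. e m 0) ` {..<n}"
    by blast
  show thesis
  proof
    show "countable (range e)" by simp
    show "dense_in double_arrow_power (range e)"
      unfolding dense_in_def dense_intersects_open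
    proof (intro conjI allI impI)
      show "range e \<subseteq> topspace double_arrow_power"
        using e(1) by (auto simp: rational_box_def topspace_double_arrow_power)
      fix U assume "openin double_arrow_power U \<and> U \<noteq> {}"
      then obtain l where "l \<in> L" "rational_box l \<subseteq> U"
        using double_arrow_power_pi_base L_def by metis
      then obtain n where "rational_box (c n) \<subseteq> U" using c by blast
      then show "range e \<inter> U \<noteq> {}" using e(1) by blast
    qed
    have "e m 0 \<noteq> e n 0" if "m < n" for m n
      using e(2)[of n] that by (metis image_eqI lessThan_iff)
    then show "inj_on (\<lambda>x. x 0) (range e)"
      unfolding inj_on_def by (metis linorder_neqE_nat rangeE)
  qed
qed

section \<open>The two dense sets and the contradiction\<close>

theorem mainTheorem2:
  shows "\<not> countable_dense_homogeneous double_arrow_power"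
proof
  assume cdh: "countable_dense_homogeneous double_arrow_power"
  obtain E where E: "countable E" "dense_in double_arrow_power E" "inj_on (\<lambda>x. x 0) E"
    by (rule dense_set_inj_on_coordinate)
  define g :: "(nat \<Rightarrow> bool) \<Rightarrow> nat \<Rightarrow> real \<times> nat"
    \<comment> \<open>The two points spanning the Cantor cube are the greatest and the least point
      of the double arrow space.\<close>
    where "g s i = (if s i then (1, 0) else (0, 1))" for s i
  have g_cont: "continuous_map cantor_cube double_arrow_power g"
    unfolding double_arrow_power_def continuous_map_componentwise_UNIV
  proof
    fix i
    have "continuous_map (discrete_topology UNIV) double_arrow (\<lambda>b. if b then (1, 0) else (0, 1))"
      by (auto simp: continuous_map_from_discrete_topology double_arrow_set_def)
    then have "continuous_map cantor_cube double_arrow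
        ((\<lambda>b. if b then (1, 0) else (0, 1)) \<circ> (\<lambda>s. s i))"
      by (intro continuous_map_compose[OF continuous_map_product_projection]) auto
    then show "continuous_map cantor_cube double_arrow (\<lambda>s. g s i)"
      by (simp add: g_def o_def)
  qed
  have g_range: "range g \<subseteq> topspace double_arrow_power"
    using continuous_map_image_subset_topspace[OF g_cont] by simp
  have g_inj: "inj g"
    by (rule injI) (auto simp: g_def fun_eq_iff split: if_splits)
  \<comment> \<open>Including \<open>E\<close> makes \<open>D\<close> dense in the power; the
    embedded Cantor rationals are the part on which \<open>h\<close> is tested.\<close>
  define D where "D = E \<union> g ` cantor_rationals"
  have "countable D"
    using E(1) countable_cantor_rationals by (simp add: D_def)
  moreover have "dense_in double_arrow_power D"
    using E(2) g_range unfolding dense_in_def dense_intersects_open D_def by blast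
  ultimately obtain h where h: "homeomorphic_map double_arrow_power double_arrow_power h" "h ` D = E"
    using cdh E(1,2) unfolding countable_dense_homogeneous_def by blast
  define f where "f = (\<lambda>s. h (g s) 0)"
  have "continuous_map cantor_cube double_arrow_power (h \<circ> g)"
    using continuous_map_compose[OF g_cont homeomorphic_imp_continuous_map[OF h(1)]] .
  then have f_cont: "continuous_map cantor_cube double_arrow f"
    unfolding double_arrow_power_def continuous_map_componentwise_UNIV f_def by (simp add: o_def)
  have "countable (range f)"
    using countable_image_double_arrow[OF second_countable_cantor_cube f_cont] by simp
  then have "\<not> inj_on f cantor_rationals"
    by (rule not_inj_on_cantor_rationals[OF f_cont Hausdorff_space_double_arrow])
  \<comment> \<open>\<open>g\<close> and \<open>h\<close> are injective, \<open>h\<close> sends the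
    embedded rationals into \<open>E\<close>, and coordinate 0 separates the points of
    \<open>E\<close>.\<close>
  moreover have "inj_on f cantor_rationals"
  proof (rule inj_onI)
    fix s t assume st: "s \<in> cantor_rationals" "t \<in> cantor_rationals" "f s = f t"
    then have "h (g s) \<in> E" "h (g t) \<in> E"
      using h(2) by (auto simp: D_def)
    then have "h (g s) = h (g t)"
      using E(3) st(3) by (auto simp: f_def inj_on_def)
    then have "g s = g t"
      using inj_onD[OF homeomorphic_imp_injective_map[OF h(1)]] g_range by blast
    then show "s = t" using g_inj by (simp add: inj_def)
  qed
  ultimately show False by blast
qed

end
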